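(* Let $\{\omega,\xi\}$ be a non-degenerate affine distribution on an $n$-dimensional manifold $M$ with $\mathrm{Im}(d\omega_x)\subset\mathrm{Im}(\omega_x)$ for every $x\in M$, and let $\nabla,g,\eta,B$ be determined by $$X\omega(Y)=\omega(\nabla_XY)+g(X,Y)\xi,\qquad X\xi=-\omega(B(X))+\eta(X)\xi,$$ for $X,Y\in\Gamma^\infty(TM)$. Then $(M,g,\eta,\nabla)$ is a semi-Weyl manifold admitting torsion (SWMT), and the curvature tensor of $\nabla$ is $$R^\nabla(X,Y)Z=g(Y,Z)B(X)-g(X,Z)B(Y)$$ for all $X,Y,Z\in\Gamma^\infty(TM)$.
   Context: An affine distribution $\{\omega,\xi\}$ on an $n$-dimensional manifold $M$ consists of an $\mathbb R^{n+1}$-valued $1$-form $\omega$ and an $\mathbb R^{n+1}$-valued function $\xi$ on $M$ (both smooth) such that $\mathbb R^{n+1}=\mathrm{Im}(\omega_x)\oplus\mathbb R\xi_x$ for all $x\in M$ (so each $\omega_x:T_xM\to\mathbb R^{n+1}$ is injective). $X\omega(Y)$ and $X\xi$ denote the derivatives along $X$ of the $\mathbb R^{n+1}$-valued functions $\omega(Y)$ and $\xi$; decomposing them along $\mathrm{Im}(\omega)\oplus\mathbb R\xi$ defines an affine connection $\nabla$, a $(0,2)$-tensor field $g$ (symmetric under the assumption $\mathrm{Im}(d\omega_x)\subset\mathrm{Im}(\omega_x)$), a $1$-form $\eta$ and a $(1,1)$-tensor field $B$ on $M$. The affine distribution is called non-degenerate if $g$ is non-degenerate (so $g$ is a pseudo-Riemannian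 metric). $T^\nabla(X,Y)=\nabla_XY-\nabla_YX-[X,Y]$, $R^\nabla(X,Y)=\nabla_X\nabla_Y-\nabla_Y\nabla_X-\nabla_{[X,Y]}$. $(M,g,\eta,\nabla)$ is a SWMT if $g$ is a pseudo-Riemannian metric and $(\nabla_Xg)(Y,Z)+\eta(X)g(Y,Z)=(\nabla_Yg)(X,Z)+\eta(Y)g(X,Z)-g(T^\nabla(X,Y),Z)$ for all vector fields $X,Y,Z$. *)

theory Defs
  imports "HOL-Analysis.Analysis" "HOL-Library.Function_Algebras"
begin

section \<open>Smooth maps between Euclidean spaces\<close>

text \<open>Intended for open \<open>S\<close>: \<open>f\<close> is \<open>C\<^sup>k\<^sup>+\<^sup>1\<close> iff it is differentiable and all its
  directional derivatives are \<open>C\<^sup>k\<close>.\<close>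

primrec Ck_on :: "nat \<Rightarrow> 'a::euclidean_space set \<Rightarrow> ('a \<Rightarrow> 'b::real_normed_vector) \<Rightarrow> bool" where
  "Ck_on 0 S f \<longleftrightarrow> continuous_on S f"
| "Ck_on (Suc k) S f \<longleftrightarrow>
     (\<forall>x\<in>S. f differentiable (at x)) \<and>
     (\<forall>v. Ck_on k S (\<lambda>x. frechet_derivative f (at x) v))"

definition smooth_on :: "'a::euclidean_space set \<Rightarrow> ('a \<Rightarrow> 'b::real_normed_vector) \<Rightarrow> bool" where
  "smooth_on S f \<longleftrightarrow> (\<forall>k. Ck_on k S f)"


section \<open>Smooth manifolds\<close>

text \<open>The manifold is the whole (Hausdorff, second countable) type \<open>'m\<close>; its smooth structure is
  given by an atlas \<open>A\<close>, and its dimension is \<open>CARD('n)\<close>.\<close>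

type_synonym ('m, 'n) chart = "'m set \<times> ('m \<Rightarrow> real ^ 'n)"

definition is_chart :: "('m::topological_space, 'n::finite) chart \<Rightarrow> bool" where
  "is_chart c \<longleftrightarrow> (case c of (U, \<phi>) \<Rightarrow>
     open U \<and> open (\<phi> ` U) \<and> (\<exists>\<psi>. homeomorphism U (\<phi> ` U) \<phi> \<psi>))"

definition smooth_manifold ::
  "('m::{t2_space, second_countable_topology}, 'n::finite) chart set \<Rightarrow> bool" where
  "smooth_manifold A \<longleftrightarrow>
     (\<forall>c\<in>A. is_chart c) \<and> (\<Union>(fst ` A)) = UNIV \<and>
     (\<forall>(U, \<phi>)\<in>A. \<forall>(V, \<psi>)\<in>A. smooth_on (\<phi> ` (U \<inter> V)) (\<psi> \<circ> inv_into U \<phi>))"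

definition smooth_map ::
  "('m, 'n::finite) chart set \<Rightarrow> ('m \<Rightarrow> 'v::real_normed_vector) \<Rightarrow> bool" where
  "smooth_map A f \<longleftrightarrow> (\<forall>(U, \<phi>)\<in>A. smooth_on (\<phi> ` U) (f \<circ> inv_into U \<phi>))"


section \<open>Tangent vectors, vector fields and tensor fields\<close>

instantiation "fun" :: (type, real_vector) real_vector
begin

definition scaleR_fun :: "real \<Rightarrow> ('a \<Rightarrow> 'b) \<Rightarrow> 'a \<Rightarrow> 'b" where
  "scaleR_fun c f = (\<lambda>x. c *\<^sub>R f x)"

instance
  by standard (simp_all add: scaleR_fun_def fun_eq_iff scaleR_add_right scaleR_add_left)

end

type_synonym 'm tangent = "('m \<Rightarrow> real) \<Rightarrow> real"

text \<open>Tangent vectors at \<open>x\<close> are the derivations at \<open>x\<close> of the algebra of smooth functions.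
  They are set to \<open>0\<close> on non-smooth functions, so that two tangent vectors are equal
  as soon as they agree on smooth functions.\<close>

definition tangent_space :: "('m, 'n::finite) chart set \<Rightarrow> 'm \<Rightarrow> 'm tangent set" where
  "tangent_space A x = {v.
     (\<forall>f. \<not> smooth_map A f \<longrightarrow> v f = 0) \<and>
     (\<forall>f g. smooth_map A f \<longrightarrow> smooth_map A g \<longrightarrow> v (f + g) = v f + v g) \<and>
     (\<forall>c f. smooth_map A f \<longrightarrow> v (c *\<^sub>R f) = c * v f) \<and>
     (\<forall>f g. smooth_map A f \<longrightarrow> smooth_map A g \<longrightarrow> v (f * g) = v f * g x + f x * v g)}"

type_synonym 'm vector_field = "'m \<Rightarrow> 'm tangent"

definition vector_fields :: "('m, 'n::finite) chart set \<Rightarrow> 'm vector_field set" where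
  "vector_fields A = {X. (\<forall>x. X x \<in> tangent_space A x) \<and>
     (\<forall>f. smooth_map A f \<longrightarrow> smooth_map A (\<lambda>x. X x f))}"

text \<open>Derivative of a vector-valued function along a tangent vector, componentwise.\<close>

definition deriv_along :: "'m tangent \<Rightarrow> ('m \<Rightarrow> real ^ 'k::finite) \<Rightarrow> real ^ 'k" where
  "deriv_along v F = (\<chi> i. v (\<lambda>y. F y $ i))"

definition lie_bracket :: "'m vector_field \<Rightarrow> 'm vector_field \<Rightarrow> 'm vector_field" where
  "lie_bracket X Y = (\<lambda>x f. X x (\<lambda>y. Y y f) - Y x (\<lambda>y. X y f))"

definition linear_on_set :: "'a::real_vector set \<Rightarrow> ('a \<Rightarrow> 'b::real_vector) \<Rightarrow> bool" where
  "linear_on_set S L \<longleftrightarrow>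
     (\<forall>v\<in>S. \<forall>w\<in>S. L (v + w) = L v + L w) \<and> (\<forall>c. \<forall>v\<in>S. L (c *\<^sub>R v) = c *\<^sub>R L v)"

text \<open>In the following three definitions smoothness of a tensor field is expressed by evaluation
  on smooth vector fields.\<close>

definition one_form ::
  "('m, 'n::finite) chart set \<Rightarrow> ('m \<Rightarrow> 'm tangent \<Rightarrow> 'v::real_normed_vector) \<Rightarrow> bool" where
  "one_form A \<omega> \<longleftrightarrow>
     (\<forall>x. linear_on_set (tangent_space A x) (\<omega> x)) \<and>
     (\<forall>X\<in>vector_fields A. smooth_map A (\<lambda>x. \<omega> x (X x)))"

definition tensor_field_0_2 ::
  "('m, 'n::finite) chart set \<Rightarrow> ('m \<Rightarrow> 'm tangent \<Rightarrow> 'm tangent \<Rightarrow> real) \<Rightarrow> bool" where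
  "tensor_field_0_2 A g \<longleftrightarrow>
     (\<forall>x. \<forall>v\<in>tangent_space A x.
        linear_on_set (tangent_space A x) (g x v) \<and>
        linear_on_set (tangent_space A x) (\<lambda>w. g x w v)) \<and>
     (\<forall>X\<in>vector_fields A. \<forall>Y\<in>vector_fields A. smooth_map A (\<lambda>x. g x (X x) (Y x)))"

definition tensor_field_1_1 ::
  "('m, 'n::finite) chart set \<Rightarrow> ('m \<Rightarrow> 'm tangent \<Rightarrow> 'm tangent) \<Rightarrow> bool" where
  "tensor_field_1_1 A B \<longleftrightarrow>
     (\<forall>x. B x ` tangent_space A x \<subseteq> tangent_space A x \<and>
        linear_on_set (tangent_space A x) (B x)) \<and>
     (\<forall>X\<in>vector_fields A. (\<lambda>x. B x (X x)) \<in> vector_fields A)"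

definition ext_deriv ::
  "('m \<Rightarrow> 'm tangent \<Rightarrow> real ^ 'k::finite) \<Rightarrow> 'm vector_field \<Rightarrow> 'm vector_field \<Rightarrow> 'm \<Rightarrow> real ^ 'k"
  where
  "ext_deriv \<omega> X Y x =
     deriv_along (X x) (\<lambda>y. \<omega> y (Y y)) - deriv_along (Y x) (\<lambda>y. \<omega> y (X y))
       - \<omega> x (lie_bracket X Y x)"

text \<open>The image of the bilinear map \<open>d\<omega>\<^sub>x\<close>; every tangent vector at \<open>x\<close> is the value at \<open>x\<close>
  of a vector field.\<close>

definition ext_deriv_image ::
  "('m, 'n::finite) chart set \<Rightarrow> ('m \<Rightarrow> 'm tangent \<Rightarrow> real ^ 'k::finite) \<Rightarrow> 'm \<Rightarrow> (real ^ 'k) set"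
  where
  "ext_deriv_image A \<omega> x =
     {ext_deriv \<omega> X Y x | X Y. X \<in> vector_fields A \<and> Y \<in> vector_fields A}"

definition nondegenerate ::
  "('m, 'n::finite) chart set \<Rightarrow> ('m \<Rightarrow> 'm tangent \<Rightarrow> 'm tangent \<Rightarrow> real) \<Rightarrow> bool" where
  "nondegenerate A g \<longleftrightarrow>
     (\<forall>x. \<forall>v\<in>tangent_space A x. (\<forall>w\<in>tangent_space A x. g x v w = 0) \<longrightarrow> v = 0)"

definition pseudo_riemannian_metric ::
  "('m, 'n::finite) chart set \<Rightarrow> ('m \<Rightarrow> 'm tangent \<Rightarrow> 'm tangent \<Rightarrow> real) \<Rightarrow> bool" where
  "pseudo_riemannian_metric A g \<longleftrightarrow>
     tensor_field_0_2 A g \<and>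
     (\<forall>x. \<forall>v\<in>tangent_space A x. \<forall>w\<in>tangent_space A x. g x v w = g x w v) \<and>
     nondegenerate A g"


section \<open>Affine connections\<close>

type_synonym 'm connection = "'m vector_field \<Rightarrow> 'm vector_field \<Rightarrow> 'm vector_field"

definition affine_connection :: "('m, 'n::finite) chart set \<Rightarrow> 'm connection \<Rightarrow> bool" where
  "affine_connection A D \<longleftrightarrow>
     (\<forall>X\<in>vector_fields A. \<forall>Y\<in>vector_fields A. D X Y \<in> vector_fields A) \<and>
     (\<forall>X\<in>vector_fields A. \<forall>Y\<in>vector_fields A. \<forall>Z\<in>vector_fields A.
        D (X + Y) Z = D X Z + D Y Z \<and> D X (Y + Z) = D X Y + D X Z) \<and>
     (\<forall>f. smooth_map A f \<longrightarrow> (\<forall>X\<in>vector_fields A. \<forall>Y\<in>vector_fields A.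
        D (\<lambda>x. f x *\<^sub>R X x) Y = (\<lambda>x. f x *\<^sub>R D X Y x) \<and>
        D X (\<lambda>x. f x *\<^sub>R Y x) = (\<lambda>x. X x f *\<^sub>R Y x + f x *\<^sub>R D X Y x)))"

definition torsion :: "'m connection \<Rightarrow> 'm vector_field \<Rightarrow> 'm vector_field \<Rightarrow> 'm vector_field" where
  "torsion D X Y = D X Y - D Y X - lie_bracket X Y"

definition curvature ::
  "'m connection \<Rightarrow> 'm vector_field \<Rightarrow> 'm vector_field \<Rightarrow> 'm vector_field \<Rightarrow> 'm vector_field" where
  "curvature D X Y Z = D X (D Y Z) - D Y (D X Z) - D (lie_bracket X Y) Z"

text \<open>\<open>(\<nabla>\<^sub>X g)(Y, Z)\<close> at the point \<open>x\<close>.\<close>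

definition cov_deriv_0_2 ::
  "'m connection \<Rightarrow> ('m \<Rightarrow> 'm tangent \<Rightarrow> 'm tangent \<Rightarrow> real) \<Rightarrow>
   'm vector_field \<Rightarrow> 'm vector_field \<Rightarrow> 'm vector_field \<Rightarrow> 'm \<Rightarrow> real" where
  "cov_deriv_0_2 D g X Y Z x =
     X x (\<lambda>y. g y (Y y) (Z y)) - g x (D X Y x) (Z x) - g x (Y x) (D X Z x)"

text \<open>Semi-Weyl manifolds admitting torsion.\<close>

definition SWMT ::
  "('m, 'n::finite) chart set \<Rightarrow> ('m \<Rightarrow> 'm tangent \<Rightarrow> 'm tangent \<Rightarrow> real) \<Rightarrow>
   ('m \<Rightarrow> 'm tangent \<Rightarrow> real) \<Rightarrow> 'm connection \<Rightarrow> bool" where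
  "SWMT A g \<eta> D \<longleftrightarrow>
     pseudo_riemannian_metric A g \<and> one_form A \<eta> \<and> affine_connection A D \<and>
     (\<forall>X\<in>vector_fields A. \<forall>Y\<in>vector_fields A. \<forall>Z\<in>vector_fields A. \<forall>x.
        cov_deriv_0_2 D g X Y Z x + \<eta> x (X x) * g x (Y x) (Z x) =
        cov_deriv_0_2 D g Y X Z x + \<eta> x (Y x) * g x (X x) (Z x) - g x (torsion D X Y x) (Z x))"


section \<open>Affine distributions\<close>

definition affine_distribution ::
  "('m, 'n::finite) chart set \<Rightarrow> ('m \<Rightarrow> 'm tangent \<Rightarrow> real ^ 'k::finite) \<Rightarrow> ('m \<Rightarrow> real ^ 'k) \<Rightarrow> bool"
  where
  "affine_distribution A \<omega> \<xi> \<longleftrightarrow>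
     CARD('k) = CARD('n) + 1 \<and> one_form A \<omega> \<and> smooth_map A \<xi> \<and>
     (\<forall>x. {a + b | a b. a \<in> \<omega> x ` tangent_space A x \<and> b \<in> span {\<xi> x}} = UNIV \<and>
          \<omega> x ` tangent_space A x \<inter> span {\<xi> x} = {0})"

end

theory Submission
  imports Defs
begin

text \<open>The second derivatives of \<open>\<omega>(Z)\<close> satisfy \<open>X(Y\<omega>(Z)) - Y(X\<omega>(Z)) - [X,Y]\<omega>(Z) = 0\<close>.
  Expanding with the structure equations, the part along \<open>Im \<omega>\<close> is the formula for the curvature and
  the part along \<open>\<xi>\<close> is the SWMT identity; symmetry of \<open>g\<close> is the vanishing of the part of \<open>d\<omega>\<close>
  along \<open>\<xi>\<close>. Reading off components requires \<open>\<omega>\<^sub>x\<close> to be injective and \<open>\<xi>\<^sub>x \<noteq> 0\<close>. Both follow by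
  counting dimensions, once derivations at a point are known to be directional derivatives in a
  chart, which rests on bump functions and Hadamard's lemma.\<close>

section \<open>Calculus of smooth maps\<close>

text \<open>Injectivity of \<omega> at a point is not part of \<open>affine_distribution\<close>,
  which speaks only about images and the number \<open>CARD('k) = CARD('n) + 1\<close>. It has to
  come from the bound dim \<le> n for the space of derivations, and this bound is the analytic core:
  a derivation acts on globally defined smooth functions, while Taylor expansion and coordinates
  exist only inside a chart. Every local function is therefore multiplied by a bump and extended by
  zero before a derivation sees it. The same cut-off turns a single tangent vector into a global
  vector field; this is what makes a pointwise claim such as the symmetry of \<open>g\<close>
  accessible, since the structure equations are given for vector fields only.\<close>

lemma Ck_on_subset: "Ck_on k S f \<Longrightarrow> T \<subseteq> S \<Longrightarrow> Ck_on k T f"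
  by (induction k arbitrary: f) (auto intro: continuous_on_subset)

lemma Ck_on_Suc_imp: "Ck_on (Suc k) S f \<Longrightarrow> Ck_on k S f"
proof (induction k arbitrary: f)
  case 0
  then show ?case
    by (auto intro!: continuous_at_imp_continuous_on differentiable_imp_continuous_within)
next
  case (Suc k)
  then show ?case by (metis Ck_on.simps(2))
qed

lemma Ck_on_imp_continuous_on: "Ck_on k S f \<Longrightarrow> continuous_on S f"
proof (induction k)
  case (Suc k)
  then show ?case using Ck_on_Suc_imp by blast
qed simp

text \<open>\<open>Ck_on\<close> uses derivatives \<open>at x\<close> in the full space, so pieces
  on different open sets share the same derivatives and no matching condition arises. This is the
  gluing principle for functions extended by zero.\<close>

lemma Ck_on_local:
  assumes "\<And>x. x \<in> S \<Longrightarrow> \<exists>T. open T \<and> x \<in> T \<and> Ck_on k T f"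
  shows "Ck_on k S f"
  using assms
proof (induction k arbitrary: f)
  case 0
  show ?case
  proof (rule continuous_at_imp_continuous_on[THEN Ck_on.simps(1)[THEN iffD2]], rule ballI)
    fix x assume "x \<in> S"
    with 0 obtain T where "open T" "x \<in> T" "Ck_on 0 T f" by blast
    then show "isCont f x" by (simp add: continuous_on_eq_continuous_at)
  qed
next
  case (Suc k)
  show ?case unfolding Ck_on.simps
  proof (intro conjI ballI allI)
    fix x assume "x \<in> S"
    with Suc.prems show "f differentiable at x" by fastforce
  next
    fix v
    show "Ck_on k S (\<lambda>x. frechet_derivative f (at x) v)"
      by (rule Suc.IH) (use Suc.prems in fastforce)
  qed
qed

lemma Ck_on_cong:
  assumes "Ck_on k S f" "open S" "\<And>x. x \<in> S \<Longrightarrow> f x = g x"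
  shows "Ck_on k S g"
  using assms(1,3)
proof (induction k arbitrary: f g)
  case 0
  then show ?case by (metis Ck_on.simps(1) continuous_on_cong)
next
  case (Suc k)
  have der: "(g has_derivative frechet_derivative f (at x)) (at x)" if "x \<in> S" for x
    by (rule has_derivative_transform_within_open[where f = f, OF _ assms(2) that])
      (use Suc.prems that in \<open>auto simp: frechet_derivative_works[symmetric]\<close>)
  then have eq: "frechet_derivative g (at x) = frechet_derivative f (at x)" if "x \<in> S" for x
    using frechet_derivative_at[OF der[OF that]] by simp
  show ?case unfolding Ck_on.simps
  proof (intro conjI ballI allI)
    fix x assume "x \<in> S" then show "g differentiable at x"
      using der differentiable_def by blast
  next
    fix v show "Ck_on k S (\<lambda>x. frechet_derivative g (at x) v)"
      by (rule Suc.IH[where f = "\<lambda>x. frechet_derivative f (at x) v"])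
        (use Suc.prems eq in auto)
  qed
qed

text \<open>Uniqueness of the derivative allows any explicit \<open>f'\<close> in place of the
  chosen \<open>frechet_derivative\<close>; the closure rules below become inductions on
  \<open>k\<close> through the usual differentiation rules.\<close>

lemma Ck_on_SucI:
  assumes "open S" "\<And>x. x \<in> S \<Longrightarrow> (f has_derivative f' x) (at x)"
    "\<And>v. Ck_on k S (\<lambda>x. f' x v)"
  shows "Ck_on (Suc k) S f"
  unfolding Ck_on.simps
proof (intro conjI ballI allI)
  fix x assume "x \<in> S" then show "f differentiable at x"
    using assms(2) differentiable_def by blast
next
  fix v
  have "f' x = frechet_derivative f (at x)" if "x \<in> S" for x
    using assms(2)[OF that] by (rule frechet_derivative_at)
  then show "Ck_on k S (\<lambda>x. frechet_derivative f (at x) v)"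
    by (intro Ck_on_cong[OF assms(3)[of v] assms(1)]) simp
qed

lemma Ck_on_SucD:
  assumes "Ck_on (Suc k) S f" "x \<in> S"
  shows "(f has_derivative frechet_derivative f (at x)) (at x)"
  using assms frechet_derivative_works by auto

lemma Ck_on_const: "open S \<Longrightarrow> Ck_on k S (\<lambda>x. c)"
  by (induction k arbitrary: c) (auto intro: Ck_on_SucI[OF _ has_derivative_const] simp del: Ck_on.simps(2))

lemma Ck_on_add:
  assumes "open S" "Ck_on k S f" "Ck_on k S g"
  shows "Ck_on k S (\<lambda>x. f x + g x)"
  using assms(2,3)
proof (induction k arbitrary: f g)
  case 0
  then show ?case by (simp add: continuous_on_add)
next
  case (Suc k)
  show ?case
    by (rule Ck_on_SucI[OF assms(1) has_derivative_add[OF Ck_on_SucD[OF Suc.prems(1)]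
          Ck_on_SucD[OF Suc.prems(2)]]]) (use Suc in auto)
qed

lemma Ck_on_bilinear:
  assumes "bounded_bilinear p" "open S" "Ck_on k S f" "Ck_on k S g"
  shows "Ck_on k S (\<lambda>x. p (f x) (g x))"
  using assms(3,4)
proof (induction k arbitrary: f g)
  case 0
  then show ?case by (simp add: bounded_bilinear.continuous_on[OF assms(1)])
next
  case (Suc k)
  show ?case
    by (rule Ck_on_SucI[OF assms(2) bounded_bilinear.FDERIV[OF assms(1) Ck_on_SucD[OF Suc.prems(1)]
          Ck_on_SucD[OF Suc.prems(2)]]])
      (use Suc in \<open>auto intro!: Ck_on_add[OF assms(2)] Suc.IH intro: Ck_on_Suc_imp\<close>)
qed

lemma Ck_on_bounded_linear:
  assumes "bounded_linear h" "open S" "Ck_on k S f"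
  shows "Ck_on k S (\<lambda>x. h (f x))"
  using assms(3)
proof (induction k arbitrary: f)
  case 0
  then show ?case by (simp add: bounded_linear.continuous_on[OF assms(1)])
next
  case (Suc k)
  show ?case
    by (rule Ck_on_SucI[OF assms(2) bounded_linear.has_derivative[OF assms(1) Ck_on_SucD[OF Suc.prems]]])
      (use Suc in auto)
qed

lemma Ck_on_ident: "open S \<Longrightarrow> Ck_on k S (\<lambda>x. x)"
  by (cases k) (auto intro: Ck_on_SucI[OF _ has_derivative_ident] Ck_on_const simp del: Ck_on.simps(2))

lemma Ck_on_sum:
  assumes "open S" "\<And>i. i \<in> I \<Longrightarrow> Ck_on k S (f i)"
  shows "Ck_on k S (\<lambda>x. \<Sum>i\<in>I. f i x)"
  using assms(2)
  by (induction I rule: infinite_finite_induct) (auto intro!: Ck_on_const Ck_on_add assms(1))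

lemma linear_Basis_expansion:
  assumes "linear h"
  shows "h v = (\<Sum>b\<in>Basis. (v \<bullet> b) *\<^sub>R h b)"
  by (metis (no_types, lifting) assms euclidean_representation linear_scale linear_sum sum.cong)

text \<open>In the chain rule the direction in which \<open>f\<close> is differentiated varies with
  \<open>x\<close>, whereas \<open>Ck_on\<close> controls fixed directions only. Expanding that
  direction in \<open>Basis\<close> leaves sums of products of functions covered by the induction
  hypothesis.\<close>

lemma Ck_on_compose:
  fixes g :: "'a::euclidean_space \<Rightarrow> 'b::euclidean_space"
  assumes "open S" "open T" "g ` S \<subseteq> T" "Ck_on k S g" "Ck_on k T f"
  shows "Ck_on k S (\<lambda>x. f (g x))"
  using assms(4,5)
proof (induction k arbitrary: f)
  case 0
  then show ?case using assms(3) by (auto intro: continuous_on_compose2)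
next
  case (Suc k)
  have der: "((\<lambda>x. f (g x)) has_derivative (\<lambda>v. \<Sum>b\<in>Basis.
      (frechet_derivative g (at x) v \<bullet> b) *\<^sub>R frechet_derivative f (at (g x)) b)) (at x)"
    if "x \<in> S" for x
  proof -
    have f: "(f has_derivative frechet_derivative f (at (g x))) (at (g x))"
      using Ck_on_SucD[OF Suc.prems(2)] that assms(3) by blast
    show ?thesis
      using has_derivative_compose[OF Ck_on_SucD[OF Suc.prems(1) that] f]
      by (subst (asm) linear_Basis_expansion[OF has_derivative_linear[OF f]])
  qed
  show ?case
    by (rule Ck_on_SucI[OF assms(1) der])
      (use Suc in \<open>auto intro!: Ck_on_sum[OF assms(1)] assms(1) Ck_on_bilinear[OF bounded_bilinear_scaleR]
        Ck_on_bounded_linear[OF bounded_linear_inner_left] Suc.IH intro: Ck_on_Suc_imp\<close>)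
qed

section \<open>Closure rules for smooth maps\<close>

lemma smooth_onI: "(\<And>k. Ck_on k S f) \<Longrightarrow> smooth_on S f"
  by (simp add: smooth_on_def)

lemma smooth_onD: "smooth_on S f \<Longrightarrow> Ck_on k S f"
  by (simp add: smooth_on_def)

lemma smooth_on_subset: "smooth_on S f \<Longrightarrow> T \<subseteq> S \<Longrightarrow> smooth_on T f"
  by (meson smooth_on_def Ck_on_subset)

lemma smooth_on_cong:
  "smooth_on S f \<Longrightarrow> open S \<Longrightarrow> (\<And>x. x \<in> S \<Longrightarrow> f x = g x) \<Longrightarrow> smooth_on S g"
  by (meson smooth_on_def Ck_on_cong)

lemma smooth_on_const: "open S \<Longrightarrow> smooth_on S (\<lambda>x. c)"
  by (simp add: smooth_on_def Ck_on_const)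

lemma smooth_on_ident: "open S \<Longrightarrow> smooth_on S (\<lambda>x. x)"
  by (simp add: smooth_on_def Ck_on_ident)

lemma smooth_on_add:
  "open S \<Longrightarrow> smooth_on S f \<Longrightarrow> smooth_on S g \<Longrightarrow> smooth_on S (\<lambda>x. f x + g x)"
  by (simp add: smooth_on_def Ck_on_add)

lemma smooth_on_bilinear:
  "bounded_bilinear p \<Longrightarrow> open S \<Longrightarrow> smooth_on S f \<Longrightarrow> smooth_on S g \<Longrightarrow>
    smooth_on S (\<lambda>x. p (f x) (g x))"
  by (simp add: smooth_on_def Ck_on_bilinear)

lemmas smooth_on_mult = smooth_on_bilinear[OF bounded_bilinear_mult]

lemma smooth_on_bounded_linear:
  "bounded_linear h \<Longrightarrow> open S \<Longrightarrow> smooth_on S f \<Longrightarrow> smooth_on S (\<lambda>x. h (f x))"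
  by (simp add: smooth_on_def Ck_on_bounded_linear)

lemma smooth_on_compose:
  fixes g :: "'a::euclidean_space \<Rightarrow> 'b::euclidean_space"
  shows "open S \<Longrightarrow> open T \<Longrightarrow> g ` S \<subseteq> T \<Longrightarrow> smooth_on S g \<Longrightarrow> smooth_on T f \<Longrightarrow>
    smooth_on S (\<lambda>x. f (g x))"
  by (simp add: smooth_on_def Ck_on_compose)

lemma smooth_on_union:
  assumes "open S" "open T" "smooth_on S f" "smooth_on T f"
  shows "smooth_on (S \<union> T) f"
  using assms by (intro smooth_onI Ck_on_local) (auto dest: smooth_onD)

lemma smooth_on_has_derivative:
  "smooth_on S f \<Longrightarrow> x \<in> S \<Longrightarrow> (f has_derivative frechet_derivative f (at x)) (at x)"
  using Ck_on_SucD smooth_onD by blast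

lemma smooth_on_frechet_derivative:
  "smooth_on S f \<Longrightarrow> smooth_on S (\<lambda>x. frechet_derivative f (at x) v)"
  by (rule smooth_onI) (use smooth_onD[where k = "Suc _"] Ck_on.simps(2) in blast)

section \<open>Bump functions and Hadamard's lemma\<close>

text \<open>Every derivative of \<open>exp (- 1 / t)\<close> is a combination of the functions
  \<open>t\<^sup>-\<^sup>m exp (- 1 / t)\<close>.\<close>

definition flat_exp :: "nat \<Rightarrow> real \<Rightarrow> real" where
  "flat_exp m t = (if t > 0 then (1 / t) ^ m * exp (- (1 / t)) else 0)"

lemma flat_exp_tendsto: "(flat_exp m \<longlongrightarrow> 0) (at 0)"
proof -
  have "((\<lambda>x. x ^ m / exp x) \<longlongrightarrow> (0::real)) at_top"
    by (rule tendsto_power_div_exp_0)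
  then have "((\<lambda>t. (1 / t) ^ m / exp (1 / t)) \<longlongrightarrow> (0::real)) (at_right 0)"
    by (rule filterlim_compose)
      (use filterlim_inverse_at_top_right in \<open>simp add: inverse_eq_divide\<close>)
  moreover have "\<forall>\<^sub>F t in at_right 0. (1 / t) ^ m / exp (1 / t) = flat_exp m t"
    by (auto simp: eventually_at_filter flat_exp_def exp_minus divide_inverse)
  ultimately have "(flat_exp m \<longlongrightarrow> 0) (at_right 0)"
    using tendsto_cong by fast
  moreover have "(flat_exp m \<longlongrightarrow> 0) (at_left 0)"
    by (rule tendsto_eventually) (auto simp: eventually_at_filter flat_exp_def)
  ultimately show ?thesis
    using filterlim_split_at by blast
qed

lemma flat_exp_DERIV:
  "(flat_exp m has_real_derivative flat_exp (m + 2) t - real m * flat_exp (m + 1) t) (at t)"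
proof -
  consider "t > 0" | "t < 0" | "t = 0" by linarith
  then show ?thesis
  proof cases
    case 1
    \<comment> \<open>The power rule produces the truncated exponent \<open>m - 1\<close>; splitting
      on \<open>m\<close> removes it.\<close>
    have "((\<lambda>t. (1 / t) ^ m * exp (- (1 / t))) has_real_derivative
        flat_exp (m + 2) t - real m * flat_exp (m + 1) t) (at t)"
      using 1 by (auto intro!: derivative_eq_intros simp: flat_exp_def; cases m;
        auto simp: field_simps power2_eq_square)
    then show ?thesis
      by (rule has_field_derivative_transform_within_open[where S = "{0<..}"])
        (use 1 in \<open>auto simp: flat_exp_def\<close>)
  next
    case 2
    have "((\<lambda>t. 0) has_real_derivative flat_exp (m + 2) t - real m * flat_exp (m + 1) t) (at t)"
      using 2 by (simp add: flat_exp_def)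
    then show ?thesis
      by (rule has_field_derivative_transform_within_open[where S = "{..<0}"])
        (use 2 in \<open>auto simp: flat_exp_def\<close>)
  next
    case 3
    \<comment> \<open>Dividing by \<open>h\<close> raises the exponent by one, so the difference
      quotient at \<open>0\<close> is again a member of the family and tends to
      \<open>0\<close>.\<close>
    have "\<forall>\<^sub>F h in at 0. flat_exp (Suc m) h = (flat_exp m (0 + h) - flat_exp m 0) / h"
      by (auto simp: eventually_at_filter flat_exp_def)
    then have "((\<lambda>h. (flat_exp m (0 + h) - flat_exp m 0) / h) \<longlongrightarrow> 0) (at 0)"
      using flat_exp_tendsto[of "Suc m"] tendsto_cong by fast
    then show ?thesis
      using 3 by (simp add: DERIV_def flat_exp_def)
  qed
qed

lemma smooth_flat_exp: "smooth_on UNIV (flat_exp m)"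
proof (rule smooth_onI)
  fix k show "Ck_on k UNIV (flat_exp m)"
  proof (induction k arbitrary: m)
    case 0
    show ?case
      by (auto intro!: continuous_at_imp_continuous_on DERIV_isCont[OF flat_exp_DERIV])
  next
    case (Suc k)
    have "Ck_on k UNIV (\<lambda>t. (flat_exp (m + 2) t + (- real m) * flat_exp (m + 1) t) * v)" for v
      by (intro Ck_on_add Ck_on_bilinear[OF bounded_bilinear_mult] Ck_on_const Suc open_UNIV)
    then show ?case
      by (intro Ck_on_SucI[OF open_UNIV flat_exp_DERIV[unfolded has_field_derivative_def]]) simp
  qed
qed

text \<open>The squared distance is a polynomial, so the only delicate place is the sphere of radius
  \<open>r\<close>, where all derivatives of \<open>flat_exp 0\<close> vanish.\<close>

definition bump :: "'a::euclidean_space \<Rightarrow> real \<Rightarrow> 'a \<Rightarrow> real" where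
  "bump a r z = flat_exp 0 (r\<^sup>2 - (z - a) \<bullet> (z - a))"

lemma smooth_bump: "smooth_on UNIV (bump a r)"
proof -
  have d: "smooth_on UNIV (\<lambda>z. z + (- a))"
    by (intro smooth_on_add smooth_on_ident smooth_on_const open_UNIV)
  have "smooth_on UNIV (\<lambda>z. r\<^sup>2 + - ((z + (- a)) \<bullet> (z + (- a))))"
    by (intro smooth_on_add smooth_on_const smooth_on_bounded_linear[OF bounded_linear_minus[OF bounded_linear_ident]]
        smooth_on_bilinear[OF bounded_bilinear_inner] d open_UNIV)
  then have "smooth_on UNIV (\<lambda>z. flat_exp 0 (r\<^sup>2 + - ((z + (- a)) \<bullet> (z + (- a)))))"
    by (rule smooth_on_compose[OF open_UNIV open_UNIV subset_UNIV _ smooth_flat_exp])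
  then show ?thesis
    by (simp add: bump_def[abs_def])
qed

lemma bump_center: "r > 0 \<Longrightarrow> bump a r a > 0"
  by (simp add: bump_def flat_exp_def)

lemma bump_outside:
  assumes "r > 0" "z \<notin> cball a r"
  shows "bump a r z = 0"
proof -
  have "r\<^sup>2 \<le> (norm (z - a))\<^sup>2"
    using assms by (intro power_mono) (auto simp: dist_norm norm_minus_commute)
  then show ?thesis by (simp add: bump_def flat_exp_def power2_norm_eq_inner)
qed

section \<open>Integrals along segments from the centre of a ball\<close>

lemma segment_in_ball:
  fixes a z :: "'a::real_normed_vector"
  assumes "z \<in> ball a r" "t \<in> {0..1}"
  shows "a + t *\<^sub>R (z - a) \<in> ball a r"
proof -
  have "t * norm (z - a) \<le> norm (z - a)"
    using assms(2) by (simp add: mult_left_le_one_le)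
  then show ?thesis
    using assms by (simp add: dist_norm norm_minus_commute)
qed

lemma continuous_on_segment:
  fixes F :: "'a::real_normed_vector \<Rightarrow> real"
  assumes "continuous_on (ball a r) F" "z \<in> ball a r"
  shows "continuous_on {0..1} (\<lambda>t. F (a + t *\<^sub>R (z - a)))"
  by (rule continuous_on_compose2[OF assms(1)])
    (auto intro!: continuous_intros segment_in_ball[OF assms(2)] simp del: mem_ball)

lemma continuous_on_segment_param:
  fixes F :: "'a::euclidean_space \<Rightarrow> real"
  assumes "continuous_on (ball a r) F"
  shows "continuous_on (ball a r \<times> {0..1}) (\<lambda>(z, t). t ^ m * F (a + t *\<^sub>R (z - a)))"
  unfolding split_beta
  by (intro continuous_intros continuous_on_compose2[OF assms])
    (auto intro!: segment_in_ball simp del: mem_ball)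

text \<open>Differentiation under the integral sign: each derivative in \<open>z\<close> brings out
  one factor \<open>t\<close> by the chain rule. The weight \<open>t ^ m\<close> with arbitrary
  \<open>m\<close> keeps the claim stable under the induction.\<close>

lemma Ck_on_segment_integral:
  fixes F :: "'a::euclidean_space \<Rightarrow> real"
  assumes "Ck_on k (ball a r) F"
  shows "Ck_on k (ball a r) (\<lambda>z. integral {0..1} (\<lambda>t. t ^ m * F (a + t *\<^sub>R (z - a))))"
  using assms
proof (induction k arbitrary: F m)
  case 0
  then show ?case
    using integral_continuous_on_param[of "ball a r" 0 "1::real" "\<lambda>z t. t ^ m * F (a + t *\<^sub>R (z - a))"]
      continuous_on_segment_param[of a r F m] by simp
next
  case (Suc k)
  \<comment> \<open>The derivative of the integrand in \<open>z\<close>, packed as a bounded linear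
    map because the Leibniz rule asks for continuity in operator norm.\<close>
  define D where "D z t = Blinfun (\<lambda>v. t ^ Suc m * frechet_derivative F (at (a + t *\<^sub>R (z - a))) v)"
    for z :: 'a and t :: real
  have F': "(F has_derivative frechet_derivative F (at z)) (at z)" if "z \<in> ball a r" for z
    using Ck_on_SucD[OF Suc.prems that] .
  have D: "blinfun_apply (D z t) = (\<lambda>v. t ^ Suc m * frechet_derivative F (at (a + t *\<^sub>R (z - a))) v)"
    if "z \<in> ball a r" "t \<in> {0..1}" for z t
    unfolding D_def
    by (rule bounded_linear_Blinfun_apply, rule bounded_linear_const_mult,
        rule has_derivative_bounded_linear, rule F', rule segment_in_ball[OF that])
  have comp: "continuous_on (ball a r \<times> {0..1}) (\<lambda>(z, t). blinfun_apply (D z t) v)" for v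
  proof -
    have "continuous_on (ball a r) (\<lambda>z. frechet_derivative F (at z) v)"
      by (rule Ck_on_imp_continuous_on[of k]) (use Suc.prems in simp)
    from continuous_on_segment_param[OF this, of "Suc m"] show ?thesis
      by (rule continuous_on_eq) (auto simp: D)
  qed
  \<comment> \<open>In finite dimension, continuity in every fixed direction gives continuity in
    operator norm.\<close>
  have cont: "continuous_on (ball a r \<times> {0..1}) (\<lambda>(z, t). D z t)"
    by (rule continuous_on_blinfun_componentwise) (use comp in \<open>simp add: split_beta\<close>)
  have deriv: "((\<lambda>z. t ^ m * F (a + t *\<^sub>R (z - a))) has_derivative blinfun_apply (D z t))
      (at z within ball a r)" if "z \<in> ball a r" "t \<in> {0..1}" for z t
  proof -
    note F'' = F'[OF segment_in_ball[OF that]]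
    have "((\<lambda>z. t ^ m * F (a + t *\<^sub>R (z - a))) has_derivative
        (\<lambda>v. t ^ m * frechet_derivative F (at (a + t *\<^sub>R (z - a))) (t *\<^sub>R v))) (at z)"
      by (rule has_derivative_mult_right, rule has_derivative_compose[where f = "\<lambda>z. a + t *\<^sub>R (z - a)" and g = F, OF _ F''])
        (auto intro!: derivative_eq_intros)
    then show ?thesis
      by (simp add: D[OF that] linear_scale[OF has_derivative_linear[OF F'']] mult.left_commute mult.assoc
          has_derivative_at_withinI)
  qed
  have int: "(\<lambda>t. t ^ m * F (a + t *\<^sub>R (z - a))) integrable_on {0..1}" if "z \<in> ball a r" for z
  proof (rule integrable_continuous_real)
    have "continuous_on (ball a r) F"
      by (meson F' continuous_at_imp_continuous_on has_derivative_continuous)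
    then show "continuous_on {0..1} (\<lambda>t. t ^ m * F (a + t *\<^sub>R (z - a)))"
      by (intro continuous_on_mult continuous_on_power continuous_on_id continuous_on_segment[OF _ that])
  qed
  show ?case
  proof (rule Ck_on_SucI)
    show "open (ball a r)" by simp
    fix z assume z: "z \<in> ball a r"
    show "((\<lambda>z. integral {0..1} (\<lambda>t. t ^ m * F (a + t *\<^sub>R (z - a)))) has_derivative
        blinfun_apply (integral {0..1} (D z))) (at z)"
      unfolding at_within_open[OF z open_ball, symmetric]
      by (rule leibniz_rule[where a = 0 and b = "1::real" and fx = D, unfolded cbox_interval])
        (fact deriv int cont z convex_ball)+
  next
    fix v
    have "Ck_on k (ball a r) (\<lambda>z. integral {0..1} (\<lambda>t. t ^ Suc m *
        frechet_derivative F (at (a + t *\<^sub>R (z - a))) v))"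
      by (rule Suc.IH) (use Suc.prems in simp)
    then show "Ck_on k (ball a r) (\<lambda>z. blinfun_apply (integral {0..1} (D z)) v)"
    proof (rule Ck_on_cong[OF _ open_ball])
      fix z assume z: "z \<in> ball a r"
      have "continuous_on {0..1} (\<lambda>t. (\<lambda>(z, t). D z t) (z, t))"
        by (rule continuous_on_compose2[OF cont]) (use z in \<open>auto intro!: continuous_intros\<close>)
      then have "continuous_on {0..1} (D z)" by simp
      then have "D z integrable_on {0..1}" by (rule integrable_continuous_real)
      from blinfun_apply_integral[OF this, of v]
      show "integral {0..1} (\<lambda>t. t ^ Suc m * frechet_derivative F (at (a + t *\<^sub>R (z - a))) v) =
          blinfun_apply (integral {0..1} (D z)) v"
        using integral_cong[of "{0..1}" "\<lambda>t. blinfun_apply (D z t) v"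
            "\<lambda>t. t ^ Suc m * frechet_derivative F (at (a + t *\<^sub>R (z - a))) v"] D[OF z]
        by simp
    qed
  qed
qed

text \<open>The fundamental theorem of calculus on the segment from \<open>a\<close> to
  \<open>z\<close> writes \<open>F z - F a\<close> as an integral of derivatives in direction
  \<open>z - a\<close>. Expanding \<open>z - a\<close> in \<open>Basis\<close> leaves the averaged
  partial derivatives \<open>h b\<close>; at \<open>z = a\<close> the average is over a
  constant.\<close>

lemma hadamard:
  fixes F :: "'a::euclidean_space \<Rightarrow> real"
  assumes F: "smooth_on (ball a r) F"
  obtains h where "\<And>b. smooth_on (ball a r) (h b)" "\<And>b. h b a = frechet_derivative F (at a) b"
    "\<And>z. z \<in> ball a r \<Longrightarrow> F z = F a + (\<Sum>b\<in>Basis. ((z - a) \<bullet> b) * h b z)"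
proof
  define h where "h b z = integral {0..1} (\<lambda>t. t ^ 0 * frechet_derivative F (at (a + t *\<^sub>R (z - a))) b)"
    for b z
  show "smooth_on (ball a r) (h b)" for b
    unfolding h_def
    by (rule smooth_onI, rule Ck_on_segment_integral, rule smooth_onD,
        rule smooth_on_frechet_derivative, rule F)
  show "h b a = frechet_derivative F (at a) b" for b
    by (simp add: h_def)
  fix z assume z: "z \<in> ball a r"
  have der: "((\<lambda>t. F (a + t *\<^sub>R (z - a))) has_real_derivative
      frechet_derivative F (at (a + t *\<^sub>R (z - a))) (z - a)) (at t within {0..1})"
    if "t \<in> {0..1}" for t
  proof -
    note F' = smooth_on_has_derivative[OF F segment_in_ball[OF z that]]
    have "((\<lambda>t. F (a + t *\<^sub>R (z - a))) has_derivative
        (\<lambda>s. frechet_derivative F (at (a + t *\<^sub>R (z - a))) (s *\<^sub>R (z - a)))) (at t)"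
      by (rule has_derivative_compose[where f = "\<lambda>t. a + t *\<^sub>R (z - a)" and g = F, OF _ F']) (auto intro!: derivative_eq_intros)
    then have "((\<lambda>t. F (a + t *\<^sub>R (z - a))) has_real_derivative
        frechet_derivative F (at (a + t *\<^sub>R (z - a))) (z - a)) (at t)"
      by (simp add: has_field_derivative_def linear_scale[OF has_derivative_linear[OF F']]
          mult.commute[of _ "frechet_derivative F _ _"])
    then show ?thesis by (rule has_field_derivative_at_within)
  qed
  have "((\<lambda>t. frechet_derivative F (at (a + t *\<^sub>R (z - a))) (z - a)) has_integral
      F (a + 1 *\<^sub>R (z - a)) - F (a + 0 *\<^sub>R (z - a))) {0..1}"
    by (rule fundamental_theorem_of_calculus)
      (use der in \<open>auto simp: has_real_derivative_iff_has_vector_derivative\<close>)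
  then have 1: "F z - F a = integral {0..1} (\<lambda>t. frechet_derivative F (at (a + t *\<^sub>R (z - a))) (z - a))"
    by (simp add: integral_unique)
  have int: "(\<lambda>t. frechet_derivative F (at (a + t *\<^sub>R (z - a))) b) integrable_on {0..1}" for b
  proof (rule integrable_continuous_real)
    have "continuous_on (ball a r) (\<lambda>z. frechet_derivative F (at z) b)"
      using smooth_onD[OF smooth_on_frechet_derivative[OF F], of 0] by simp
    then show "continuous_on {0..1} (\<lambda>t. frechet_derivative F (at (a + t *\<^sub>R (z - a))) b)"
      by (rule continuous_on_segment[OF _ z])
  qed
  have "F z - F a = integral {0..1} (\<lambda>t. \<Sum>b\<in>Basis. ((z - a) \<bullet> b) *
      frechet_derivative F (at (a + t *\<^sub>R (z - a))) b)"
    unfolding 1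
    by (rule integral_cong) (use linear_Basis_expansion[OF has_derivative_linear[OF
          smooth_on_has_derivative[OF F segment_in_ball[OF z]]], of _ "z - a"] in simp)
  also have "\<dots> = (\<Sum>b\<in>Basis. ((z - a) \<bullet> b) * h b z)"
    using int by (simp add: integral_sum h_def integrable_on_mult_right)
  finally show "F z = F a + (\<Sum>b\<in>Basis. ((z - a) \<bullet> b) * h b z)" by simp
qed

section \<open>Smooth functions on a manifold\<close>

text \<open>\<open>is_chart\<close> merely asserts that some inverse exists. It agrees with
  \<open>inv_into U \<phi>\<close> on the image, which carries its continuity over to the inverse
  used in \<open>smooth_map\<close>.\<close>

lemma chart_facts:
  assumes "smooth_manifold A" "(U, \<phi>) \<in> A"
  shows "open U" "open (\<phi> ` U)" "inj_on \<phi> U" "continuous_on U \<phi>"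
    "continuous_on (\<phi> ` U) (inv_into U \<phi>)"
proof -
  from assms have c: "is_chart (U, \<phi>)"
    by (auto simp: smooth_manifold_def)
  then obtain \<psi> where h: "homeomorphism U (\<phi> ` U) \<phi> \<psi>" "open U" "open (\<phi> ` U)"
    by (auto simp: is_chart_def)
  then show "open U" "open (\<phi> ` U)" "continuous_on U \<phi>"
    by (auto simp: homeomorphism_def)
  show inj: "inj_on \<phi> U"
    using h(1) by (auto simp: homeomorphism_def intro: inj_on_inverseI)
  have "inv_into U \<phi> z = \<psi> z" if "z \<in> \<phi> ` U" for z
    using h(1) that inj by (auto simp: homeomorphism_def)
  then show "continuous_on (\<phi> ` U) (inv_into U \<phi>)"
    using h(1) continuous_on_cong[of "\<phi> ` U" "\<phi> ` U" "inv_into U \<phi>" \<psi>]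
    by (simp add: homeomorphism_def)
qed

lemma chart_image_open:
  assumes "smooth_manifold A" "(U, \<phi>) \<in> A" "open T" "T \<subseteq> U"
  shows "open (\<phi> ` T)"
proof -
  note c = chart_facts[OF assms(1,2)]
  have inv: "inv_into U \<phi> (\<phi> y) = y" if "y \<in> U" for y
    using that c(3) by simp
  have "\<phi> ` T = \<phi> ` U \<inter> inv_into U \<phi> -` T"
  proof
    show "\<phi> ` T \<subseteq> \<phi> ` U \<inter> inv_into U \<phi> -` T"
      using assms(4) inv by fastforce
    show "\<phi> ` U \<inter> inv_into U \<phi> -` T \<subseteq> \<phi> ` T"
      using inv by fastforce
  qed
  with continuous_open_preimage[OF c(5,2) assms(3)] show ?thesis by simp
qed

lemma chart_at:
  assumes "smooth_manifold A"
  obtains U \<phi> where "(U, \<phi>) \<in> A" "x \<in> U"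
proof -
  have "x \<in> \<Union> (fst ` A)" using assms by (simp add: smooth_manifold_def)
  then show ?thesis using that by auto
qed

lemma smooth_mapD: "smooth_map A f \<Longrightarrow> (U, \<phi>) \<in> A \<Longrightarrow> smooth_on (\<phi> ` U) (f \<circ> inv_into U \<phi>)"
  by (auto simp: smooth_map_def)

lemma smooth_map_const: "smooth_manifold A \<Longrightarrow> smooth_map A (\<lambda>x. c)"
  by (auto simp: smooth_map_def o_def intro!: smooth_on_const chart_facts)

lemma smooth_map_add:
  "smooth_manifold A \<Longrightarrow> smooth_map A f \<Longrightarrow> smooth_map A g \<Longrightarrow> smooth_map A (\<lambda>x. f x + g x)"
  unfolding smooth_map_def o_def by (fast intro!: smooth_on_add chart_facts)

lemma smooth_map_bilinear:
  assumes "bounded_bilinear p" "smooth_manifold A" "smooth_map A f" "smooth_map A g"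
  shows "smooth_map A (\<lambda>x. p (f x) (g x))"
  using assms(2-) unfolding smooth_map_def o_def
  by (fast intro!: smooth_on_bilinear[OF assms(1)] chart_facts)

lemmas smooth_map_mult = smooth_map_bilinear[OF bounded_bilinear_mult]

lemma smooth_map_bounded_linear:
  assumes "bounded_linear h" "smooth_manifold A" "smooth_map A f"
  shows "smooth_map A (\<lambda>x. h (f x))"
  using assms(2-) unfolding smooth_map_def o_def
  by (fast intro!: smooth_on_bounded_linear[OF assms(1)] chart_facts)

lemma smooth_map_sum:
  assumes "smooth_manifold A" "\<And>i. i \<in> I \<Longrightarrow> smooth_map A (f i)"
  shows "smooth_map A (\<lambda>x. \<Sum>i\<in>I. f i x)"
  using assms(2)
  by (induction I rule: infinite_finite_induct) (auto intro!: smooth_map_const smooth_map_add assms(1))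

section \<open>Extension by zero of functions given in a chart\<close>

definition chart_extend ::
  "'m set \<Rightarrow> ('m \<Rightarrow> 'a) \<Rightarrow> ('a \<Rightarrow> 'b::zero) \<Rightarrow> 'm \<Rightarrow> 'b" where
  "chart_extend U \<phi> u y = (if y \<in> U then u (\<phi> y) else 0)"

text \<open>In another chart the domain \<open>V\<close> is covered by two open sets: on
  \<open>T\<close> the extension is \<open>u\<close> composed with a smooth transition map, off the
  compact set \<open>K\<close> it is zero.\<close>

lemma smooth_map_chart_extend:
  fixes A :: "('m::{t2_space, second_countable_topology}, 'n::finite) chart set"
    and u :: "real ^ 'n \<Rightarrow> 'b::real_normed_vector"
  assumes A: "smooth_manifold A" and U: "(U, \<phi>) \<in> A" and R: "ball a R \<subseteq> \<phi> ` U" "\<rho> < R"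
    and u: "smooth_on (ball a R) u" and u0: "\<And>z. z \<notin> cball a \<rho> \<Longrightarrow> u z = 0"
  shows "smooth_map A (chart_extend U \<phi> u)"
  unfolding smooth_map_def
proof clarify
  fix V \<psi> assume V: "(V, \<psi>) \<in> A"
  note cU = chart_facts[OF A U] and cV = chart_facts[OF A V]
  define K where "K = inv_into U \<phi> ` cball a \<rho>"
  define T where "T = V \<inter> (U \<inter> \<phi> -` ball a R)"
  have sub: "cball a \<rho> \<subseteq> \<phi> ` U" using R by auto
  have "compact K"
    unfolding K_def by (rule compact_continuous_image) (use cU(5) sub continuous_on_subset in auto)
  \<comment> \<open>The Hausdorff property enters here: compactness makes \<open>K\<close> closed in
    the whole manifold and not merely in \<open>U\<close>.\<close>
  then have oK: "open (V - K)" using cV(1) by (simp add: compact_imp_closed open_Diff)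
  have oT: "open T"
    unfolding T_def by (intro open_Int cV(1) continuous_open_preimage[OF cU(4,1)] open_ball)
  have K: "y \<in> K \<longleftrightarrow> y \<in> U \<and> \<phi> y \<in> cball a \<rho>" for y
  proof
    assume "y \<in> K" then obtain z where z: "z \<in> cball a \<rho>" "y = inv_into U \<phi> z"
      by (auto simp: K_def)
    with sub have "z \<in> \<phi> ` U" by auto
    with z show "y \<in> U \<and> \<phi> y \<in> cball a \<rho>"
      by (auto simp: inv_into_into f_inv_into_f simp del: mem_cball)
  next
    assume "y \<in> U \<and> \<phi> y \<in> cball a \<rho>" then show "y \<in> K"
      unfolding K_def using cU(3) by (metis image_eqI inv_into_f_f)
  qed
  \<comment> \<open>Points of \<open>K\<close> lie in \<open>T\<close> because
    \<open>\<rho> < R\<close>.\<close>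
  have "V = T \<union> (V - K)"
    unfolding T_def using K R(2) by auto
  then have eq: "\<psi> ` V = \<psi> ` T \<union> \<psi> ` (V - K)" by (metis image_Un)
  have o1: "open (\<psi> ` T)" and o2: "open (\<psi> ` (V - K))"
    using chart_image_open[OF A V] oT oK by (auto simp: T_def)
  have "smooth_on (\<psi> ` (V \<inter> U)) (\<phi> \<circ> inv_into V \<psi>)"
    using A U V by (auto simp: smooth_manifold_def)
  then have "smooth_on (\<psi> ` T) (\<phi> \<circ> inv_into V \<psi>)"
    by (rule smooth_on_subset) (auto simp: T_def)
  moreover have "(\<phi> \<circ> inv_into V \<psi>) ` \<psi> ` T \<subseteq> ball a R"
    using cV(3) by (auto simp: T_def)
  ultimately have "smooth_on (\<psi> ` T) (\<lambda>z. u ((\<phi> \<circ> inv_into V \<psi>) z))"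
    using smooth_on_compose[OF o1 open_ball _ _ u] by blast
  then have 1: "smooth_on (\<psi> ` T) (chart_extend U \<phi> u \<circ> inv_into V \<psi>)"
    by (rule smooth_on_cong[OF _ o1]) (use cV(3) in \<open>auto simp: T_def chart_extend_def\<close>)
  have 2: "smooth_on (\<psi> ` (V - K)) (chart_extend U \<phi> u \<circ> inv_into V \<psi>)"
    by (rule smooth_on_cong[OF smooth_on_const[OF o2, of 0] o2])
      (use cV(3) K u0 in \<open>auto simp: chart_extend_def\<close>)
  show "smooth_on (\<psi> ` V) (chart_extend U \<phi> u \<circ> inv_into V \<psi>)"
    unfolding eq by (rule smooth_on_union[OF o1 o2 1 2])
qed

section \<open>Tangent spaces\<close>

lemma tangent_nonsmooth: "v \<in> tangent_space A x \<Longrightarrow> \<not> smooth_map A f \<Longrightarrow> v f = 0"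
  by (simp add: tangent_space_def)

lemma tangent_add:
  "v \<in> tangent_space A x \<Longrightarrow> smooth_map A f \<Longrightarrow> smooth_map A g \<Longrightarrow> v (\<lambda>y. f y + g y) = v f + v g"
  by (simp add: tangent_space_def plus_fun_def)

lemma tangent_scale:
  "v \<in> tangent_space A x \<Longrightarrow> smooth_map A f \<Longrightarrow> v (\<lambda>y. c * f y) = c * v f"
  by (simp add: tangent_space_def scaleR_fun_def)

lemma tangent_mult:
  "v \<in> tangent_space A x \<Longrightarrow> smooth_map A f \<Longrightarrow> smooth_map A g \<Longrightarrow>
    v (\<lambda>y. f y * g y) = v f * g x + f x * v g"
  by (simp add: tangent_space_def times_fun_def)

lemma tangent_spaceI:
  assumes "\<And>f. \<not> smooth_map A f \<Longrightarrow> v f = 0"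
    and "\<And>f g. smooth_map A f \<Longrightarrow> smooth_map A g \<Longrightarrow> v (\<lambda>y. f y + g y) = v f + v g"
    and "\<And>c f. smooth_map A f \<Longrightarrow> v (\<lambda>y. c * f y) = c * v f"
    and "\<And>f g. smooth_map A f \<Longrightarrow> smooth_map A g \<Longrightarrow> v (\<lambda>y. f y * g y) = v f * g x + f x * v g"
  shows "v \<in> tangent_space A x"
  using assms by (simp add: tangent_space_def plus_fun_def times_fun_def scaleR_fun_def)

lemma tangent_zero:
  assumes "smooth_manifold A" "v \<in> tangent_space A x"
  shows "v (\<lambda>y. 0) = 0"
  using tangent_scale[OF assms(2) smooth_map_const[OF assms(1)], of 0] by simp

lemma tangent_sum:
  assumes "smooth_manifold A" "v \<in> tangent_space A x" "\<And>i. i \<in> I \<Longrightarrow> smooth_map A (f i)"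
  shows "v (\<lambda>y. \<Sum>i\<in>I. f i y) = (\<Sum>i\<in>I. v (f i))"
  using assms(3)
proof (induction I rule: infinite_finite_induct)
  case (insert i I)
  then show ?case
    using tangent_add[OF assms(2), of "f i" "\<lambda>y. \<Sum>i\<in>I. f i y"] smooth_map_sum[OF assms(1), of I f]
    by simp
qed (simp_all add: tangent_zero[OF assms(1,2)])

lemma subspace_tangent_space: "subspace (tangent_space A x)"
  unfolding subspace_def tangent_space_def
  by (auto simp: scaleR_fun_def algebra_simps)

text \<open>The coordinate vector at \<open>x\<close> with components \<open>c\<close>. The value
  \<open>0\<close> on non-smooth functions follows the convention of
  \<open>tangent_space\<close>.\<close>

definition chart_vector ::
  "('m, 'n::finite) chart set \<Rightarrow> 'm set \<Rightarrow> ('m \<Rightarrow> real ^ 'n) \<Rightarrow> 'm \<Rightarrow> real ^ 'n \<Rightarrow> 'm tangent" where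
  "chart_vector A U \<phi> x c f =
     (if smooth_map A f then frechet_derivative (f \<circ> inv_into U \<phi>) (at (\<phi> x)) c else 0)"

lemma chart_representative_derivative:
  assumes "(U, \<phi>) \<in> A" "x \<in> U" "smooth_map A f"
  shows "((f \<circ> inv_into U \<phi>) has_derivative frechet_derivative (f \<circ> inv_into U \<phi>) (at (\<phi> x))) (at (\<phi> x))"
  using smooth_on_has_derivative[OF smooth_mapD[OF assms(3,1)]] assms(2) by blast

lemma chart_vector_in_tangent_space:
  assumes A: "smooth_manifold A" and U: "(U, \<phi>) \<in> A" "x \<in> U"
  shows "chart_vector A U \<phi> x c \<in> tangent_space A x"
proof (rule tangent_spaceI)
  have x: "inv_into U \<phi> (\<phi> x) = x"
    using chart_facts(3)[OF A U(1)] U(2) by simp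
  note d = chart_representative_derivative[OF U, unfolded o_def]
  fix f g :: "'a \<Rightarrow> real" assume f: "smooth_map A f" and g: "smooth_map A g"
  show "chart_vector A U \<phi> x c (\<lambda>y. f y + g y) = chart_vector A U \<phi> x c f + chart_vector A U \<phi> x c g"
    using frechet_derivative_at[OF has_derivative_add[OF d[OF f] d[OF g]], symmetric]
    by (simp add: chart_vector_def f g smooth_map_add A o_def)
  show "chart_vector A U \<phi> x c (\<lambda>y. f y * g y) =
      chart_vector A U \<phi> x c f * g x + f x * chart_vector A U \<phi> x c g"
    using frechet_derivative_at[OF has_derivative_mult[OF d[OF f] d[OF g]], symmetric]
    by (simp add: chart_vector_def f g smooth_map_mult A o_def x)
next
  note d = chart_representative_derivative[OF U, unfolded o_def]
  fix f :: "'a \<Rightarrow> real" and k :: real assume f: "smooth_map A f"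
  have "smooth_map A (\<lambda>y. k * f y)"
    by (rule smooth_map_mult[OF A smooth_map_const[OF A] f])
  then show "chart_vector A U \<phi> x c (\<lambda>y. k * f y) = k * chart_vector A U \<phi> x c f"
    using frechet_derivative_at[OF has_derivative_mult_right[OF d[OF f], of k], symmetric]
    by (simp add: chart_vector_def f o_def)
qed (simp add: chart_vector_def)

lemma linear_chart_vector:
  assumes "smooth_manifold A" "(U, \<phi>) \<in> A" "x \<in> U"
  shows "linear (chart_vector A U \<phi> x)"
proof (rule linearI)
  note l = has_derivative_linear[OF chart_representative_derivative[OF assms(2,3)]]
  show "chart_vector A U \<phi> x (b + c) = chart_vector A U \<phi> x b + chart_vector A U \<phi> x c" for b c
    by (auto simp: chart_vector_def linear_add[OF l])
  show "chart_vector A U \<phi> x (k *\<^sub>R c) = k *\<^sub>R chart_vector A U \<phi> x c" for k c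
    by (auto simp: chart_vector_def linear_scale[OF l] scaleR_fun_def)
qed

lemma chart_ball:
  assumes "smooth_manifold A" "(U, \<phi>) \<in> A" "x \<in> U"
  obtains R where "R > 0" "ball (\<phi> x) R \<subseteq> \<phi> ` U"
  using chart_facts(2)[OF assms(1,2)] assms(3) by (metis imageI open_contains_ball)

text \<open>Half the radius leaves a margin between the support of the bump and the boundary of the
  ball, so \<open>u\<close> may behave arbitrarily outside that ball.\<close>

lemma smooth_map_bump_extend:
  assumes "smooth_manifold A" "(U, \<phi>) \<in> A" "R > 0" "ball a R \<subseteq> \<phi> ` U" "smooth_on (ball a R) u"
  shows "smooth_map A (chart_extend U \<phi> (\<lambda>z. bump a (R / 2) z * (u z :: real)))"
proof (rule smooth_map_chart_extend[OF assms(1,2,4)])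
  show "R / 2 < R" using assms(3) by simp
  show "smooth_on (ball a R) (\<lambda>z. bump a (R / 2) z * u z)"
    by (intro smooth_on_mult open_ball assms(5) smooth_on_subset[OF smooth_bump]) simp
  show "bump a (R / 2) z * u z = 0" if "z \<notin> cball a (R / 2)" for z
    using bump_outside[OF _ that] assms(3) by simp
qed

text \<open>With a bump function \<open>\<beta>\<close> supported in the chart, Hadamard's lemma gives the identity
  \<open>\<beta>\<^sup>2 f = f(x) \<beta>\<^sup>2 + (\<Sum>i. (\<beta> (\<phi>\<^sub>i - \<phi>\<^sub>i(x))) (\<beta> h\<^sub>i))\<close> of global smooth functions.\<close>

lemma tangent_space_chart_vector:
  assumes A: "smooth_manifold A" and U: "(U, \<phi>) \<in> A" "x \<in> U" and v: "v \<in> tangent_space A x"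
  obtains c where "v = chart_vector A U \<phi> x c"
proof -
  define a where "a = \<phi> x"
  obtain R where R: "R > 0" "ball a R \<subseteq> \<phi> ` U"
    using chart_ball[OF A U] by (auto simp: a_def)
  define b where "b = bump a (R / 2)"
  have ba: "b a > 0" using R(1) by (simp add: b_def bump_center)
  note ext = smooth_map_bump_extend[OF A U(1) R, folded b_def]
  \<comment> \<open>The factor \<open>1\<close> brings the bump itself into the shape covered by
    \<open>ext\<close>.\<close>
  define \<beta> where "\<beta> = chart_extend U \<phi> (\<lambda>z. b z * 1)"
  define \<beta>' where "\<beta>' i = chart_extend U \<phi> (\<lambda>z. b z * ((z - a) \<bullet> i))" for i
  have s: "smooth_map A \<beta>"
    unfolding \<beta>_def by (intro ext smooth_on_const open_ball)
  have s': "smooth_map A (\<beta>' i)" for i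
  proof -
    have "smooth_on (ball a R) (\<lambda>z. (z + (- a)) \<bullet> i)"
      by (intro smooth_on_bounded_linear[OF bounded_linear_inner_left] smooth_on_add smooth_on_ident
          smooth_on_const open_ball)
    then show ?thesis unfolding \<beta>'_def by (intro ext) simp
  qed
  \<comment> \<open>The components of \<open>v\<close> are its values on the coordinate functions.
    On their cut-off versions \<open>\<beta>' i\<close>, which vanish at \<open>x\<close>, these
    values appear multiplied by \<open>b a\<close>; hence the division.\<close>
  define c where "c = (\<Sum>i\<in>Basis. (v (\<beta>' i) / b a) *\<^sub>R i)"
  have "v f = chart_vector A U \<phi> x c f" for f
  proof (cases "smooth_map A f")
    case False
    then show ?thesis using tangent_nonsmooth[OF v] by (simp add: chart_vector_def)
  next
    case f: True
    define F where "F = f \<circ> inv_into U \<phi>"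
    have Ff: "F (\<phi> y) = f y" if "y \<in> U" for y
      using that chart_facts(3)[OF A U(1)] by (simp add: F_def)
    have "smooth_on (ball a R) F"
      unfolding F_def using smooth_mapD[OF f U(1)] R(2) by (rule smooth_on_subset)
    from hadamard[OF this] obtain h where h: "\<And>i. smooth_on (ball a R) (h i)"
      "\<And>i. h i a = frechet_derivative F (at a) i"
      "\<And>z. z \<in> ball a R \<Longrightarrow> F z = F a + (\<Sum>i\<in>Basis. ((z - a) \<bullet> i) * h i z)"
      by blast
    define H where "H i = chart_extend U \<phi> (\<lambda>z. b z * h i z)" for i
    have sH: "smooth_map A (H i)" for i
      unfolding H_def by (rule ext[OF h(1)])
    \<comment> \<open>The bump is squared because the remainder is a product of two local functions,
      and each of them needs its own factor to become global.\<close>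
    have id: "\<beta> y * \<beta> y * f y = f x * (\<beta> y * \<beta> y) + (\<Sum>i\<in>Basis. \<beta>' i y * H i y)" for y
    proof (cases "y \<in> U \<and> \<phi> y \<in> ball a R")
      case True
      then have "f y = f x + (\<Sum>i\<in>Basis. ((\<phi> y - a) \<bullet> i) * h i (\<phi> y))"
        using h(3)[of "\<phi> y"] Ff U(2) by (simp add: a_def)
      then show ?thesis
        using True by (simp add: \<beta>_def \<beta>'_def H_def chart_extend_def algebra_simps sum_distrib_left)
    next
      case False
      then have "y \<in> U \<Longrightarrow> b (\<phi> y) = 0"
        using bump_outside[of "R / 2" "\<phi> y" a] R(1) by (auto simp: b_def)
      then show ?thesis by (simp add: \<beta>_def \<beta>'_def H_def chart_extend_def)
    qed
    have x: "\<beta> x = b a" "\<beta>' i x = 0" "H i x = b a * h i a" for i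
      using U(2) by (simp_all add: \<beta>_def \<beta>'_def H_def chart_extend_def a_def)
    note ss = smooth_map_mult[OF A s s]
    have "v (\<lambda>y. \<beta> y * \<beta> y * f y) =
        v (\<lambda>y. f x * (\<beta> y * \<beta> y)) + v (\<lambda>y. \<Sum>i\<in>Basis. \<beta>' i y * H i y)"
      unfolding id by (rule tangent_add[OF v])
        (intro smooth_map_mult smooth_map_sum smooth_map_const s s' sH A)+
    also have "v (\<lambda>y. f x * (\<beta> y * \<beta> y)) = f x * v (\<lambda>y. \<beta> y * \<beta> y)"
      by (rule tangent_scale[OF v ss])
    also have "v (\<lambda>y. \<Sum>i\<in>Basis. \<beta>' i y * H i y) = (\<Sum>i\<in>Basis. v (\<lambda>y. \<beta>' i y * H i y))"
      by (rule tangent_sum[OF A v]) (intro smooth_map_mult s' sH A)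
    also have "\<dots> = (\<Sum>i\<in>Basis. v (\<beta>' i) * (b a * h i a))"
      by (intro sum.cong refl) (simp add: tangent_mult[OF v s' sH] x)
    \<comment> \<open>The Leibniz rule on the left yields the extra term
      \<open>f x * v (\<lambda>y. \<beta> y * \<beta> y)\<close>, which cancels against the first
      term on the right.\<close>
    finally have "b a * b a * v f = (\<Sum>i\<in>Basis. v (\<beta>' i) * (b a * h i a))"
      by (simp add: tangent_mult[OF v ss f] x)
    also have "\<dots> = b a * b a * (\<Sum>i\<in>Basis. v (\<beta>' i) / b a * h i a)"
      using ba by (simp add: sum_distrib_left mult.left_commute)
    finally have vf: "v f = (\<Sum>i\<in>Basis. v (\<beta>' i) / b a * h i a)"
      using ba by simp
    have l: "linear (frechet_derivative F (at a))"
      using has_derivative_linear[OF chart_representative_derivative[OF U f]] by (simp add: F_def a_def)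
    have "chart_vector A U \<phi> x c f = frechet_derivative F (at a) c"
      by (simp add: chart_vector_def f F_def a_def)
    also have "\<dots> = v f"
      by (simp add: c_def vf linear_sum[OF l] linear_scale[OF l] h(2))
    finally show ?thesis by simp
  qed
  then show ?thesis using that by blast
qed

text \<open>A coordinate field with constant components, cut off by a bump and normalised by
  \<open>b a\<close> to keep its value at \<open>x\<close>.\<close>

lemma tangent_vector_extends:
  assumes A: "smooth_manifold A" and v: "v \<in> tangent_space A x"
  obtains X where "X \<in> vector_fields A" "X x = v"
proof -
  obtain U \<phi> where U: "(U, \<phi>) \<in> A" "x \<in> U" by (rule chart_at[OF A])
  define a where "a = \<phi> x"
  obtain R where R: "R > 0" "ball a R \<subseteq> \<phi> ` U"
    using chart_ball[OF A U] by (auto simp: a_def)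
  define b where "b = bump a (R / 2)"
  have ba: "b a > 0" using R(1) by (simp add: b_def bump_center)
  obtain c where c: "v = chart_vector A U \<phi> x c"
    by (rule tangent_space_chart_vector[OF A U v])
  define X where "X y = (if y \<in> U then (b (\<phi> y) / b a) *\<^sub>R chart_vector A U \<phi> y c else 0)" for y
  have "X y \<in> tangent_space A y" for y
    using chart_vector_in_tangent_space[OF A U(1)] subspace_tangent_space[of A y]
    by (auto simp: X_def subspace_scale subspace_0)
  moreover have "smooth_map A (\<lambda>y. X y f)" if f: "smooth_map A f" for f
  proof -
    define F where "F = f \<circ> inv_into U \<phi>"
    have "smooth_on (ball a R) (\<lambda>z. 1 / b a * frechet_derivative F (at z) c)"
      unfolding F_def
      by (intro smooth_on_mult smooth_on_const open_ball smooth_on_subset[OF _ R(2)]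
          smooth_on_frechet_derivative smooth_mapD[OF f U(1)])
    from smooth_map_bump_extend[OF A U(1) R this]
    have "smooth_map A (chart_extend U \<phi> (\<lambda>z. b z * (1 / b a * frechet_derivative F (at z) c)))"
      by (simp add: b_def)
    also have "chart_extend U \<phi> (\<lambda>z. b z * (1 / b a * frechet_derivative F (at z) c)) = (\<lambda>y. X y f)"
      by (auto simp: chart_extend_def X_def chart_vector_def f F_def scaleR_fun_def)
    finally show ?thesis .
  qed
  ultimately have "X \<in> vector_fields A" by (simp add: vector_fields_def)
  moreover have "X x = v" using ba U(2) c by (simp add: X_def a_def)
  ultimately show ?thesis by (rule that)
qed

section \<open>Vector fields, Lie brackets and derivatives of vector-valued functions\<close>

lemma linear_on_set_diff:
  assumes "linear_on_set S L" "subspace S" "v \<in> S" "w \<in> S"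
  shows "L (v - w) = L v - L w"
proof -
  have "(- 1) *\<^sub>R w \<in> S"
    by (rule subspace_scale[OF assms(2,4)])
  then have "L (v + (- 1) *\<^sub>R w) = L v + (- 1) *\<^sub>R L w"
    using assms(1,3,4) unfolding linear_on_set_def by metis
  then show ?thesis by simp
qed

lemma vector_field_tangent: "X \<in> vector_fields A \<Longrightarrow> X x \<in> tangent_space A x"
  by (simp add: vector_fields_def)

lemma vector_field_smooth: "X \<in> vector_fields A \<Longrightarrow> smooth_map A f \<Longrightarrow> smooth_map A (\<lambda>x. X x f)"
  by (simp add: vector_fields_def)

text \<open>Each second derivative of a product contributes the same mixed terms, such as
  \<open>X x f * Y x g\<close>; they cancel in the commutator and leave the Leibniz rule.\<close>

lemma lie_bracket_vector_field:
  assumes A: "smooth_manifold A" and X: "X \<in> vector_fields A" and Y: "Y \<in> vector_fields A"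
  shows "lie_bracket X Y \<in> vector_fields A"
proof -
  note tX = vector_field_tangent[OF X] and tY = vector_field_tangent[OF Y]
  note sX = vector_field_smooth[OF X] and sY = vector_field_smooth[OF Y]
  have "lie_bracket X Y x \<in> tangent_space A x" for x
  proof (rule tangent_spaceI)
    fix f :: "'a \<Rightarrow> real" assume "\<not> smooth_map A f"
    \<comment> \<open>For such \<open>f\<close> the inner functions \<open>\<lambda>y. Y y f\<close>
      and \<open>\<lambda>y. X y f\<close> are constantly \<open>0\<close>.\<close>
    then show "lie_bracket X Y x f = 0"
      using tangent_nonsmooth[OF tX] tangent_nonsmooth[OF tY] tangent_zero[OF A tX] tangent_zero[OF A tY]
      by (simp add: lie_bracket_def)
  next
    fix f g :: "'a \<Rightarrow> real" assume f: "smooth_map A f" and g: "smooth_map A g"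
    show "lie_bracket X Y x (\<lambda>y. f y + g y) = lie_bracket X Y x f + lie_bracket X Y x g"
      by (simp add: lie_bracket_def tangent_add[OF tX] tangent_add[OF tY] f g sX sY)
    have "X x (\<lambda>y. Y y f * g y + f y * Y y g) =
        X x (\<lambda>y. Y y f) * g x + Y x f * X x g + (X x f * Y x g + f x * X x (\<lambda>y. Y y g))"
      by (simp add: tangent_add[OF tX] tangent_mult[OF tX] smooth_map_mult[OF A] f g sX sY)
    moreover have "Y x (\<lambda>y. X y f * g y + f y * X y g) =
        Y x (\<lambda>y. X y f) * g x + X x f * Y x g + (Y x f * X x g + f x * Y x (\<lambda>y. X y g))"
      by (simp add: tangent_add[OF tY] tangent_mult[OF tY] smooth_map_mult[OF A] f g sX sY)
    ultimately show "lie_bracket X Y x (\<lambda>y. f y * g y) =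
        lie_bracket X Y x f * g x + f x * lie_bracket X Y x g"
      by (simp add: lie_bracket_def tangent_mult[OF tX f g] tangent_mult[OF tY f g] algebra_simps)
  next
    fix c :: real and f :: "'a \<Rightarrow> real" assume f: "smooth_map A f"
    show "lie_bracket X Y x (\<lambda>y. c * f y) = c * lie_bracket X Y x f"
      by (simp add: lie_bracket_def tangent_scale[OF tX] tangent_scale[OF tY] f sX sY algebra_simps)
  qed
  moreover have "smooth_map A (\<lambda>x. lie_bracket X Y x f)" if f: "smooth_map A f" for f
  proof -
    have "smooth_map A (\<lambda>x. X x (\<lambda>y. Y y f) + - 1 * Y x (\<lambda>y. X y f))"
      by (intro smooth_map_add smooth_map_mult smooth_map_const sX sY f A)
    then show ?thesis by (simp add: lie_bracket_def)
  qed
  ultimately show ?thesis by (simp add: vector_fields_def)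
qed

lemma smooth_map_component:
  "smooth_manifold A \<Longrightarrow> smooth_map A F \<Longrightarrow> smooth_map A (\<lambda>x. F x $ i)"
  by (rule smooth_map_bounded_linear[OF bounded_linear_vec_nth])

lemma deriv_along_add:
  assumes "smooth_manifold A" "v \<in> tangent_space A x" "smooth_map A F" "smooth_map A G"
  shows "deriv_along v (\<lambda>y. F y + G y) = deriv_along v F + deriv_along v G"
  by (simp add: deriv_along_def vec_eq_iff tangent_add[OF assms(2)]
      smooth_map_component[OF assms(1,3)] smooth_map_component[OF assms(1,4)])

lemma deriv_along_scaleR:
  assumes "smooth_manifold A" "v \<in> tangent_space A x" "smooth_map A h" "smooth_map A F"
  shows "deriv_along v (\<lambda>y. h y *\<^sub>R F y) = v h *\<^sub>R F x + h x *\<^sub>R deriv_along v F"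
  by (simp add: deriv_along_def vec_eq_iff tangent_mult[OF assms(2)] assms(3)
      smooth_map_component[OF assms(1,4)])

lemma deriv_along_lie_bracket:
  "deriv_along (lie_bracket X Y x) F =
     deriv_along (X x) (\<lambda>y. deriv_along (Y y) F) - deriv_along (Y x) (\<lambda>y. deriv_along (X y) F)"
  by (simp add: deriv_along_def vec_eq_iff lie_bracket_def)

section \<open>Affine distributions\<close>

text \<open>A chart parametrises the tangent space by \<open>real ^ 'n\<close>, which bounds the
  rank of \<open>\<omega> x\<close> by \<open>CARD('n)\<close>. The direct sum forces this rank to
  be attained, so \<open>W\<close> is injective and a tangent vector \<open>L c\<close> killed by
  \<open>\<omega> x\<close> has \<open>c = 0\<close>.\<close>

lemma affine_distribution_decomposition_unique:
  fixes \<omega> :: "'m::{t2_space, second_countable_topology} \<Rightarrow> 'm tangent \<Rightarrow> real ^ 'k::finite"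
    and A :: "('m, 'n::finite) chart set"
  assumes A: "smooth_manifold A" and d: "affine_distribution A \<omega> \<xi>"
    and v: "v \<in> tangent_space A x" and eq: "\<omega> x v + s *\<^sub>R \<xi> x = 0"
  shows "v = 0" "s = 0"
proof -
  obtain U \<phi> where U: "(U, \<phi>) \<in> A" "x \<in> U" by (rule chart_at[OF A])
  define L where "L = chart_vector A U \<phi> x"
  define W where "W c = \<omega> x (L c)" for c
  have T: "tangent_space A x = range L"
    using tangent_space_chart_vector[OF A U] chart_vector_in_tangent_space[OF A U]
    unfolding L_def by blast
  have lin: "linear_on_set (tangent_space A x) (\<omega> x)"
    and card: "CARD('k) = CARD('n) + 1"
    and sum: "{a + b | a b. a \<in> \<omega> x ` tangent_space A x \<and> b \<in> span {\<xi> x}} = UNIV"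
    and int: "\<omega> x ` tangent_space A x \<inter> span {\<xi> x} = {0}"
    using d by (auto simp: affine_distribution_def one_form_def)
  have "linear L" unfolding L_def by (rule linear_chart_vector[OF A U])
  then have W: "linear W"
    using lin by (intro linearI) (auto simp: W_def linear_on_set_def T linear_add linear_scale)
  have im: "\<omega> x ` tangent_space A x = range W" by (auto simp: T W_def)
  have "dim (range W) + dim (span {\<xi> x}) = CARD('k)"
    using dim_sums_Int[OF linear_subspace_image[OF W subspace_UNIV] subspace_span, of "{\<xi> x}"]
      sum int im by simp
  moreover have "dim (range W) \<le> CARD('n)"
    using dim_image_le[OF W, of UNIV] by simp
  moreover have "dim (span {\<xi> x}) \<le> (if \<xi> x = 0 then 0 else 1)"
    by (simp add: dim_singleton)
  \<comment> \<open>The two upper bounds add up to exactly \<open>CARD('k)\<close>, so neither can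
    be strict.\<close>
  ultimately have \<xi>: "\<xi> x \<noteq> 0" and dimW: "dim (range W) = CARD('n)"
    using card by (auto split: if_splits)
  have "inj W"
    using dimW full_rank_injective[of "matrix W"] W by (simp add: rank_dim_range)
  then have ker: "c = 0" if "W c = 0" for c
    using that linear_0[OF W] by (metis injD)
  have "\<omega> x v = (- s) *\<^sub>R \<xi> x" using eq by (simp add: eq_neg_iff_add_eq_0)
  then have "\<omega> x v \<in> \<omega> x ` tangent_space A x \<inter> span {\<xi> x}"
    using v by (metis IntI image_eqI insertI1 span_base span_mul)
  with int have 0: "\<omega> x v = 0" by blast
  with eq \<xi> show "s = 0" by simp
  from v T obtain c where c: "v = L c" by blast
  with 0 ker have "c = 0" by (simp add: W_def)
  with c \<open>linear L\<close> show "v = 0" by (simp add: linear_0)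
qed

text \<open>For \<omega> the differential of an immersed affine hypersurface with transversal field
  \<xi>, \<open>gauss\<close> and \<open>weingarten\<close> are the classical formulas of these
  names and \<open>B\<close> is the shape operator.\<close>

locale induced_structure =
  fixes A :: "('m::{t2_space, second_countable_topology}, 'n::finite) chart set"
    and \<omega> :: "'m \<Rightarrow> 'm tangent \<Rightarrow> real ^ 'k::finite"
    and \<xi> :: "'m \<Rightarrow> real ^ 'k"
    and D :: "'m connection"
    and g :: "'m \<Rightarrow> 'm tangent \<Rightarrow> 'm tangent \<Rightarrow> real"
    and \<eta> :: "'m \<Rightarrow> 'm tangent \<Rightarrow> real"
    and B :: "'m \<Rightarrow> 'm tangent \<Rightarrow> 'm tangent"
  assumes manifold: "smooth_manifold A"
    and distribution: "affine_distribution A \<omega> \<xi>"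
    and connection: "affine_connection A D"
    and tensor_g: "tensor_field_0_2 A g"
    and tensor_B: "tensor_field_1_1 A B"
    and gauss: "\<And>X Y x. X \<in> vector_fields A \<Longrightarrow> Y \<in> vector_fields A \<Longrightarrow>
      deriv_along (X x) (\<lambda>y. \<omega> y (Y y)) = \<omega> x (D X Y x) + g x (X x) (Y x) *\<^sub>R \<xi> x"
    and weingarten: "\<And>X x. X \<in> vector_fields A \<Longrightarrow>
      deriv_along (X x) \<xi> = - \<omega> x (B x (X x)) + \<eta> x (X x) *\<^sub>R \<xi> x"
begin

lemmas unique = affine_distribution_decomposition_unique[OF manifold distribution]

lemma linear_omega: "linear_on_set (tangent_space A x) (\<omega> x)"
  using distribution by (simp add: affine_distribution_def one_form_def)

lemmas omega_diff = linear_on_set_diff[OF linear_omega subspace_tangent_space]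

lemma omega_scaleR: "v \<in> tangent_space A x \<Longrightarrow> \<omega> x (c *\<^sub>R v) = c *\<^sub>R \<omega> x v"
  using linear_omega by (simp add: linear_on_set_def)

lemma smooth_omega: "X \<in> vector_fields A \<Longrightarrow> smooth_map A (\<lambda>x. \<omega> x (X x))"
  using distribution by (simp add: affine_distribution_def one_form_def)

lemma smooth_xi: "smooth_map A \<xi>"
  using distribution by (simp add: affine_distribution_def)

lemma smooth_g:
  "X \<in> vector_fields A \<Longrightarrow> Y \<in> vector_fields A \<Longrightarrow> smooth_map A (\<lambda>x. g x (X x) (Y x))"
  using tensor_g by (simp add: tensor_field_0_2_def)

lemma D_vector_field:
  "X \<in> vector_fields A \<Longrightarrow> Y \<in> vector_fields A \<Longrightarrow> D X Y \<in> vector_fields A"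
  using connection by (simp add: affine_connection_def)

lemma B_tangent: "v \<in> tangent_space A x \<Longrightarrow> B x v \<in> tangent_space A x"
  using tensor_B by (auto simp: tensor_field_1_1_def)

lemma g_symmetric:
  assumes image: "\<And>x. ext_deriv_image A \<omega> x \<subseteq> \<omega> x ` tangent_space A x"
    and v: "v \<in> tangent_space A x" and w: "w \<in> tangent_space A x"
  shows "g x v w = g x w v"
proof -
  obtain X where X: "X \<in> vector_fields A" "X x = v"
    by (rule tangent_vector_extends[OF manifold v])
  obtain Y where Y: "Y \<in> vector_fields A" "Y x = w"
    by (rule tangent_vector_extends[OF manifold w])
  have "ext_deriv \<omega> X Y x \<in> \<omega> x ` tangent_space A x"
    using image[of x] X(1) Y(1) by (auto simp: ext_deriv_image_def)
  then obtain u where u: "u \<in> tangent_space A x" "ext_deriv \<omega> X Y x = \<omega> x u" by blast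
  note t = D_vector_field[OF X(1) Y(1), THEN vector_field_tangent[of _ A x]]
    D_vector_field[OF Y(1) X(1), THEN vector_field_tangent[of _ A x]]
    lie_bracket_vector_field[OF manifold X(1) Y(1), THEN vector_field_tangent[of _ A x]]
  note s = subspace_diff[OF subspace_tangent_space]
  \<comment> \<open>Torsion minus the preimage \<open>u\<close> of the value of d\<omega>: this
    collects all terms along the image of \<omega>, and only the antisymmetric part of
    \<open>g\<close> remains as coefficient of \<xi>.\<close>
  let ?t = "D X Y x - D Y X x - lie_bracket X Y x - u"
  have image_t: "\<omega> x ?t = \<omega> x (D X Y x) - \<omega> x (D Y X x) - \<omega> x (lie_bracket X Y x) - \<omega> x u"
    by (simp add: omega_diff t u(1) s)
  have u': "\<omega> x (D X Y x) + g x v w *\<^sub>R \<xi> x - (\<omega> x (D Y X x) + g x w v *\<^sub>R \<xi> x) -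
      \<omega> x (lie_bracket X Y x) = \<omega> x u"
    using u(2) gauss[OF X(1) Y(1), of x] gauss[OF Y(1) X(1), of x] X(2) Y(2)
    by (simp add: ext_deriv_def)
  have "\<omega> x ?t + (g x v w - g x w v) *\<^sub>R \<xi> x = 0"
    unfolding image_t u'[symmetric] by (simp add: algebra_simps)
  from unique(2)[OF _ this] show ?thesis
    by (simp add: s t u(1))
qed

text \<open>The Gauss formula applies to \<omega>(Z) and again to \<omega>(\<open>D Y Z\<close>);
  the Weingarten formula differentiates \<xi> in the remaining term and is the source of
  \<open>B\<close> and \<open>\<eta>\<close>.\<close>

lemma second_derivative:
  assumes X: "X \<in> vector_fields A" and Y: "Y \<in> vector_fields A" and Z: "Z \<in> vector_fields A"
  shows "deriv_along (X x) (\<lambda>y. deriv_along (Y y) (\<lambda>z. \<omega> z (Z z))) =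
    \<omega> x (D X (D Y Z) x) - g x (Y x) (Z x) *\<^sub>R \<omega> x (B x (X x)) +
    (g x (X x) (D Y Z x) + X x (\<lambda>y. g y (Y y) (Z y)) + \<eta> x (X x) * g x (Y x) (Z x)) *\<^sub>R \<xi> x"
proof -
  note t = vector_field_tangent[OF X] and YZ = D_vector_field[OF Y Z]
  have "deriv_along (X x) (\<lambda>y. deriv_along (Y y) (\<lambda>z. \<omega> z (Z z))) =
      deriv_along (X x) (\<lambda>y. \<omega> y (D Y Z y) + g y (Y y) (Z y) *\<^sub>R \<xi> y)"
    by (simp add: gauss Y Z)
  also have "\<dots> = deriv_along (X x) (\<lambda>y. \<omega> y (D Y Z y)) +
      deriv_along (X x) (\<lambda>y. g y (Y y) (Z y) *\<^sub>R \<xi> y)"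
    by (rule deriv_along_add[OF manifold t smooth_omega[OF YZ]])
      (rule smooth_map_bilinear[OF bounded_bilinear_scaleR manifold smooth_g[OF Y Z] smooth_xi])
  also have "\<dots> = \<omega> x (D X (D Y Z) x) + g x (X x) (D Y Z x) *\<^sub>R \<xi> x +
      (X x (\<lambda>y. g y (Y y) (Z y)) *\<^sub>R \<xi> x + g x (Y x) (Z x) *\<^sub>R deriv_along (X x) \<xi>)"
    by (simp add: gauss X YZ deriv_along_scaleR[OF manifold t smooth_g[OF Y Z] smooth_xi])
  finally show ?thesis
    by (simp add: weingarten X algebra_simps)
qed

text \<open>The analogues of the Gauss and Codazzi equations. The second keeps the Lie bracket;
  torsion appears only once derivatives of \<open>g\<close> are replaced by covariant ones.\<close>

lemma gauss_codazzi:
  assumes X: "X \<in> vector_fields A" and Y: "Y \<in> vector_fields A" and Z: "Z \<in> vector_fields A"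
  shows "curvature D X Y Z x = g x (Y x) (Z x) *\<^sub>R B x (X x) - g x (X x) (Z x) *\<^sub>R B x (Y x)" (is ?gauss)
    and "g x (X x) (D Y Z x) + X x (\<lambda>y. g y (Y y) (Z y)) + \<eta> x (X x) * g x (Y x) (Z x) =
      g x (Y x) (D X Z x) + Y x (\<lambda>y. g y (X y) (Z y)) + \<eta> x (Y x) * g x (X x) (Z x) +
      g x (lie_bracket X Y x) (Z x)" (is "?l = ?r")
proof -
  note XY = lie_bracket_vector_field[OF manifold X Y]
  note t = vector_field_tangent[of _ A x]
  let ?R1 = "D X (D Y Z) x" and ?R2 = "D Y (D X Z) x" and ?R3 = "D (lie_bracket X Y) Z x"
  let ?B1 = "B x (X x)" and ?B2 = "B x (Y x)"
  let ?a = "g x (Y x) (Z x)" and ?b = "g x (X x) (Z x)"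
  have R: "?R1 \<in> tangent_space A x" "?R2 \<in> tangent_space A x" "?R3 \<in> tangent_space A x"
    using X Y Z XY by (intro t D_vector_field; simp)+
  have BT: "?B1 \<in> tangent_space A x" "?B2 \<in> tangent_space A x"
    using X Y by (intro B_tangent t; simp)+
  note s = subspace_diff[OF subspace_tangent_space] subspace_scale[OF subspace_tangent_space]
  let ?T = "?R1 - ?R2 - ?R3 - (?a *\<^sub>R ?B1 - ?b *\<^sub>R ?B2)"
  have T: "?T \<in> tangent_space A x" by (simp add: s R BT)
  have "deriv_along (lie_bracket X Y x) (\<lambda>z. \<omega> z (Z z)) =
      \<omega> x ?R3 + g x (lie_bracket X Y x) (Z x) *\<^sub>R \<xi> x"
    by (rule gauss[OF XY Z])
  \<comment> \<open>\<open>?l - ?r\<close> is the \<xi>-component of the commutator identity for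
    \<omega>(Z), bracket term included.\<close>
  then have "\<omega> x ?R1 - ?a *\<^sub>R \<omega> x ?B1 - (\<omega> x ?R2 - ?b *\<^sub>R \<omega> x ?B2) - \<omega> x ?R3 +
      (?l - ?r) *\<^sub>R \<xi> x = 0"
    unfolding deriv_along_lie_bracket second_derivative[OF X Y Z] second_derivative[OF Y X Z]
    by (simp add: algebra_simps)
  moreover have "\<omega> x ?T = \<omega> x ?R1 - \<omega> x ?R2 - \<omega> x ?R3 - (?a *\<^sub>R \<omega> x ?B1 - ?b *\<^sub>R \<omega> x ?B2)"
    by (simp add: omega_diff omega_scaleR s R BT)
  ultimately have "\<omega> x ?T + (?l - ?r) *\<^sub>R \<xi> x = 0" by (simp only:) (simp add: algebra_simps)
  from unique[OF T this] have "?T = 0" "?l = ?r" by simp_all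
  then show ?gauss "?l = ?r" by (simp_all add: curvature_def)
qed

end

theorem theorem6p1:
  fixes A :: "('m::{t2_space, second_countable_topology}, 'n::finite) chart set"
    and \<omega> :: "'m \<Rightarrow> 'm tangent \<Rightarrow> real ^ 'k::finite"
    and \<xi> :: "'m \<Rightarrow> real ^ 'k"
    and D :: "'m connection"
    and g :: "'m \<Rightarrow> 'm tangent \<Rightarrow> 'm tangent \<Rightarrow> real"
    and \<eta> :: "'m \<Rightarrow> 'm tangent \<Rightarrow> real"
    and B :: "'m \<Rightarrow> 'm tangent \<Rightarrow> 'm tangent"
  assumes "smooth_manifold A"
    and "affine_distribution A \<omega> \<xi>"
    and "\<And>x. ext_deriv_image A \<omega> x \<subseteq> \<omega> x ` tangent_space A x"
    and "affine_connection A D"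
    and "tensor_field_0_2 A g"
    and "one_form A \<eta>"
    and "tensor_field_1_1 A B"
    and "\<And>X Y x. X \<in> vector_fields A \<Longrightarrow> Y \<in> vector_fields A \<Longrightarrow>
           deriv_along (X x) (\<lambda>y. \<omega> y (Y y)) = \<omega> x (D X Y x) + g x (X x) (Y x) *\<^sub>R \<xi> x"
    and "\<And>X x. X \<in> vector_fields A \<Longrightarrow>
           deriv_along (X x) \<xi> = - \<omega> x (B x (X x)) + \<eta> x (X x) *\<^sub>R \<xi> x"
    and "nondegenerate A g"
  shows "SWMT A g \<eta> D \<and>
    (\<forall>X\<in>vector_fields A. \<forall>Y\<in>vector_fields A. \<forall>Z\<in>vector_fields A.
       curvature D X Y Z =
         (\<lambda>x. g x (Y x) (Z x) *\<^sub>R B x (X x) - g x (X x) (Z x) *\<^sub>R B x (Y x)))"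
proof -
  interpret induced_structure A \<omega> \<xi> D g \<eta> B
    by unfold_locales (fact assms)+
  have "cov_deriv_0_2 D g X Y Z x + \<eta> x (X x) * g x (Y x) (Z x) =
      cov_deriv_0_2 D g Y X Z x + \<eta> x (Y x) * g x (X x) (Z x) - g x (torsion D X Y x) (Z x)"
    if X: "X \<in> vector_fields A" and Y: "Y \<in> vector_fields A" and Z: "Z \<in> vector_fields A" for X Y Z x
  proof -
    note t = vector_field_tangent[of _ A x]
    note tangents = t[OF D_vector_field[OF X Y]] t[OF D_vector_field[OF Y X]]
      t[OF lie_bracket_vector_field[OF assms(1) X Y]]
    have "linear_on_set (tangent_space A x) (\<lambda>v. g x v (Z x))"
      using assms(5) t[OF Z] by (simp add: tensor_field_0_2_def)
    note g_diff = linear_on_set_diff[OF this subspace_tangent_space]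
    \<comment> \<open>The first two terms cancel those that the covariant derivatives of
      \<open>g\<close> add to the Codazzi equation; the third matches its bracket term.\<close>
    have "g x (torsion D X Y x) (Z x) =
        g x (D X Y x) (Z x) - g x (D Y X x) (Z x) - g x (lie_bracket X Y x) (Z x)"
      by (simp add: torsion_def g_diff tangents subspace_diff[OF subspace_tangent_space])
    with gauss_codazzi(2)[OF X Y Z, of x] show ?thesis
      by (simp add: cov_deriv_0_2_def)
  qed
  then have "SWMT A g \<eta> D"
    unfolding SWMT_def pseudo_riemannian_metric_def
    by (intro conjI allI ballI assms(4,5,6,10) g_symmetric[OF assms(3)])
  then show ?thesis
    by (intro conjI ballI ext gauss_codazzi(1))
qed

end
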